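(* Let $0<\alpha<1$ and $k(0)\in(0,1)$, and let $k^\circ(t)$, $c^\circ(t)$, $\lambda^\circ(t)$ ($t=0,1,2,\dots$) be the limits as $T\to\infty$ of the optimal capital $k_T(t)$, optimal consumption $c_T(t)$ and shadow price $\lambda_T(t)$ of the undiscounted $T$-horizon problem with logarithmic utility and production function $k^\alpha$ described in the context. Then: (a) $c^\circ(t)$, $k^\circ(t)$, $\lambda^\circ(t)$ converge to finite positive values as $t\to\infty$: $$\lim_{t\to\infty}c^\circ(t)=(1-\alpha)\alpha^{\frac{\alpha}{1-\alpha}}>0,\qquad \lim_{t\to\infty}k^\circ(t)=\alpha^{\frac{1}{1-\alpha}}>0,\qquad \lim_{t\to\infty}\lambda^\circ(t)=(1-\alpha)^{-1}\alpha^{\frac{-\alpha}{1-\alpha}}>0.$$ (b) If $k(0)>\alpha^{\frac{1}{1-\alpha}}$, then $k^\circ(t)$ and $c^\circ(t)$ are monotonically decreasing in $t$ and $\lambda^\circ(t)$ is monotonically increasing in $t$. If $k(0)<\alpha^{\frac{1}{1-\alpha}}$, then $k^\circ(t)$ and $c^\circ(t)$ are monotonically increasing in $t$ and $\lambda^\circ(t)$ is monotonically decreasing in $t$. (c) If $k(0)=\alpha^{\frac{1}{1-\alpha}}$, then $k^\circ(t)$, $c^\circ(t)$ and $\lambda^\circ(t)$ are in steady state (constant in $t$).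
   Context: For an integer $T\ge 0$, the $T$-horizon problem is: maximize $\sum_{t=0}^{T}\ln c(t)$ subject to $c(t)+k(t+1)=k(t)^\alpha$ for $0\le t\le T$, $k(0)$ given, $0<k(t)<1$ for $0\le t\le T$, and $k(T+1)=0$. It has a unique optimal solution $(k_T(t),c_T(t))$. The shadow price of capital is the Lagrange multiplier $\lambda_T(t)=1/c_T(t)$ (marginal utility of consumption). Set $k^\circ(t)=\lim_{T\to\infty}k_T(t)$, $c^\circ(t)=\lim_{T\to\infty}c_T(t)$, $\lambda^\circ(t)=\lim_{T\to\infty}\lambda_T(t)$ for each fixed $t$ (these limits exist). *)

theory Defs
  imports "HOL-Analysis.Analysis"
begin

text \<open>
  A plan is a pair of a capital path \<open>k\<close> on \<open>{0..T+1}\<close> and a consumption path \<open>c\<close> on \<open>{0..T}\<close>.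
  Paths are extensional, so that two plans are equal as soon as they agree on these time ranges.
  The condition \<open>0 < c t\<close> is the domain of the logarithmic utility; it has to be
  explicit because \<open>ln\<close> is total in HOL.
\<close>

definition feasible :: "real \<Rightarrow> real \<Rightarrow> nat \<Rightarrow> (nat \<Rightarrow> real) \<times> (nat \<Rightarrow> real) \<Rightarrow> bool" where
  "feasible \<alpha> k0 T = (\<lambda>(k, c).
     k \<in> extensional {..Suc T} \<and> c \<in> extensional {..T} \<and>
     k 0 = k0 \<and>
     (\<forall>t\<le>T. 0 < k t \<and> k t < 1) \<and>
     (\<forall>t\<le>T. 0 < c t \<and> c t + k (Suc t) = k t powr \<alpha>) \<and>
     k (Suc T) = 0)"

definition total_utility :: "nat \<Rightarrow> (nat \<Rightarrow> real) \<times> (nat \<Rightarrow> real) \<Rightarrow> real" where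
  "total_utility T = (\<lambda>(k, c). \<Sum>t\<le>T. ln (c t))"

definition optimal :: "real \<Rightarrow> real \<Rightarrow> nat \<Rightarrow> (nat \<Rightarrow> real) \<times> (nat \<Rightarrow> real) \<Rightarrow> bool" where
  "optimal \<alpha> k0 T = is_arg_max (total_utility T) (feasible \<alpha> k0 T)"

definition opt_plan :: "real \<Rightarrow> real \<Rightarrow> nat \<Rightarrow> (nat \<Rightarrow> real) \<times> (nat \<Rightarrow> real)" where
  "opt_plan \<alpha> k0 T = (THE p. optimal \<alpha> k0 T p)"

definition opt_capital :: "real \<Rightarrow> real \<Rightarrow> nat \<Rightarrow> nat \<Rightarrow> real" where
  "opt_capital \<alpha> k0 T t = fst (opt_plan \<alpha> k0 T) t"

definition opt_consumption :: "real \<Rightarrow> real \<Rightarrow> nat \<Rightarrow> nat \<Rightarrow> real" where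
  "opt_consumption \<alpha> k0 T t = snd (opt_plan \<alpha> k0 T) t"

text \<open>
  The multiplier of the constraint \<open>c t + k (Suc t) = k t powr \<alpha>\<close>; stationarity of the
  Lagrangian in \<open>c t\<close> makes it the marginal utility of consumption.
\<close>

definition shadow_price :: "real \<Rightarrow> real \<Rightarrow> nat \<Rightarrow> nat \<Rightarrow> real" where
  "shadow_price \<alpha> k0 T t = 1 / opt_consumption \<alpha> k0 T t"

text \<open>
  For fixed \<open>t\<close>, the values at the finitely many horizons \<open>T < t\<close>, where \<open>t\<close> lies outside
  the planning period, do not affect the following limits.
\<close>

definition capital_lim :: "real \<Rightarrow> real \<Rightarrow> nat \<Rightarrow> real" where
  "capital_lim \<alpha> k0 t = lim (\<lambda>T. opt_capital \<alpha> k0 T t)"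

definition consumption_lim :: "real \<Rightarrow> real \<Rightarrow> nat \<Rightarrow> real" where
  "consumption_lim \<alpha> k0 t = lim (\<lambda>T. opt_consumption \<alpha> k0 T t)"

definition shadow_price_lim :: "real \<Rightarrow> real \<Rightarrow> nat \<Rightarrow> real" where
  "shadow_price_lim \<alpha> k0 t = lim (\<lambda>T. shadow_price \<alpha> k0 T t)"

end

theory Submission
  imports Defs
begin

text \<open>
  When \<open>n\<close> periods follow the current one, the capital \<open>k\<close> handed on to them is worth
  \<open>a n * ln k\<close> plus a constant, where \<open>a n = \<alpha> + \<alpha>\<^sup>2 + \<dots> + \<alpha>\<^sup>n\<close>. By the
  inequality \<open>ln x \<le> x - 1\<close>, each period of a feasible plan loses against this value function unless the share \<open>a n / (1 + a n)\<close> of output is saved;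
  summing over time telescopes and identifies the unique optimum. As \<open>T \<rightarrow> \<infinity>\<close> the saving rates
  tend to \<open>\<alpha>\<close>, so the limiting capital satisfies \<open>k (t + 1) = \<alpha> * k t powr \<alpha>\<close>. In
  logarithms this is an affine contraction around the steady state \<open>\<kappa> = \<alpha> powr (1 / (1 - \<alpha>))\<close>,
  and hence \<open>k t = \<kappa> * (k0 / \<kappa>) powr (\<alpha> ^ t)\<close>.
\<close>

section \<open>Coefficients, saving rates and candidate paths\<close>

text \<open>The geometric sum is put in closed form, so that its limit
  \<open>\<alpha> / (1 - \<alpha>)\<close> can be read off.\<close>

definition value_coeff :: "real \<Rightarrow> nat \<Rightarrow> real" where
  "value_coeff \<alpha> n = \<alpha> * (1 - \<alpha> ^ n) / (1 - \<alpha>)"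

definition saving_rate :: "real \<Rightarrow> nat \<Rightarrow> real" where
  "saving_rate \<alpha> n = value_coeff \<alpha> n / (1 + value_coeff \<alpha> n)"

text \<open>\<open>T - t\<close> counts the periods after \<open>t\<close>. At \<open>t = T\<close>
  the rate is \<open>saving_rate \<alpha> 0 = 0\<close>, which produces the terminal condition at
  \<open>Suc T\<close>.\<close>

primrec capital_path :: "real \<Rightarrow> real \<Rightarrow> nat \<Rightarrow> nat \<Rightarrow> real" where
  "capital_path \<alpha> k0 T 0 = k0"
| "capital_path \<alpha> k0 T (Suc t) = saving_rate \<alpha> (T - t) * capital_path \<alpha> k0 T t powr \<alpha>"

definition consumption_path :: "real \<Rightarrow> real \<Rightarrow> nat \<Rightarrow> nat \<Rightarrow> real" where
  "consumption_path \<alpha> k0 T t = (1 - saving_rate \<alpha> (T - t)) * capital_path \<alpha> k0 T t powr \<alpha>"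

definition candidate :: "real \<Rightarrow> real \<Rightarrow> nat \<Rightarrow> (nat \<Rightarrow> real) \<times> (nat \<Rightarrow> real)" where
  "candidate \<alpha> k0 T =
     (restrict (capital_path \<alpha> k0 T) {..Suc T}, restrict (consumption_path \<alpha> k0 T) {..T})"

definition steady_capital :: "real \<Rightarrow> real" where
  "steady_capital \<alpha> = \<alpha> powr (1 / (1 - \<alpha>))"

definition limit_path :: "real \<Rightarrow> real \<Rightarrow> nat \<Rightarrow> real" where
  "limit_path \<alpha> k0 t = steady_capital \<alpha> * (k0 / steady_capital \<alpha>) powr (\<alpha> ^ t)"

section \<open>One-period inequality and telescoping\<close>

text \<open>Weighted concavity of \<open>ln\<close>: with weights 1 and \<open>b\<close> on the two
  uses of output, the best split is 1 to \<open>b\<close>. The assumption \<open>zero\<close> admits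
  the last period, where \<open>b\<close> and \<open>z\<close> both vanish and the term
  \<open>b * ln z\<close> drops out.\<close>

lemma log_split_bound:
  fixes b c y z :: real
  assumes "0 \<le> b" and "0 < c" and "0 \<le> z" and y: "c + z = y" and zero: "b = 0 \<longleftrightarrow> z = 0"
  shows "ln c + b * ln z \<le> (1 + b) * ln y + (b * ln b - (1 + b) * ln (1 + b))"
    and "ln c + b * ln z = (1 + b) * ln y + (b * ln b - (1 + b) * ln (1 + b)) \<longleftrightarrow>
      z = b / (1 + b) * y"
proof -
  \<comment> \<open>\<open>D\<close> is the value of the left side at the optimal split of
    \<open>y = 1\<close>.\<close>
  define D where "D = b * ln b - (1 + b) * ln (1 + b)"
  have "ln c + b * ln z \<le> (1 + b) * ln y + D \<and>
    (ln c + b * ln z = (1 + b) * ln y + D \<longleftrightarrow> z = b / (1 + b) * y)"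
  proof (cases "b = 0")
    case True
    then show ?thesis using zero y by (simp add: D_def)
  next
    case False
    then have b: "0 < b" and z: "0 < z" using assms by auto
    then have ypos: "0 < y" using assms by simp
    \<comment> \<open>\<open>u\<close> and \<open>v\<close> are the ratios of \<open>c\<close> and
      \<open>z\<close> to their optimal values \<open>y / (1 + b)\<close> and
      \<open>b * y / (1 + b)\<close>. The budget fixes \<open>u + b * v\<close>, so the linear
      bounds on \<open>ln u\<close> and \<open>b * ln v\<close> cancel.\<close>
    define u where "u = c * (1 + b) / y"
    define v where "v = z * (1 + b) / (b * y)"
    have pos: "0 < u" "0 < v" using b z ypos assms by (auto simp: u_def v_def)
    have lnu: "ln u = ln c + ln (1 + b) - ln y"
      using b ypos assms by (simp add: u_def ln_mult ln_div)
    have lnv: "ln v = ln z + ln (1 + b) - (ln b + ln y)"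
      using b ypos z by (simp add: v_def ln_mult ln_div)
    have gap: "ln c + b * ln z - ((1 + b) * ln y + D) = ln u + b * ln v"
      unfolding lnu lnv D_def by (simp add: algebra_simps)
    have "u + b * v = (c + z) * (1 + b) / y"
      using b ypos by (simp add: u_def v_def field_simps)
    also have "\<dots> = 1 + b" using ypos y by simp
    finally have sum: "u - 1 + b * (v - 1) = 0" by (simp add: algebra_simps)
    have lu: "ln u \<le> u - 1" using pos ln_le_minus_one by blast
    have lv: "b * ln v \<le> b * (v - 1)" using pos ln_le_minus_one b by (simp add: mult_left_mono)
    have le: "ln c + b * ln z \<le> (1 + b) * ln y + D" using gap sum lu lv by linarith
    \<comment> \<open>The bounds \<open>lu\<close> and \<open>lv\<close> add up to zero, so equality
      makes both tight, and \<open>ln v = v - 1\<close> only at \<open>v = 1\<close>. Conversely,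
      \<open>sum\<close> then gives \<open>u = 1\<close>.\<close>
    have "ln u + b * ln v = 0 \<longleftrightarrow> v = 1"
    proof
      assume "ln u + b * ln v = 0"
      then have "b * ln v = b * (v - 1)" using lu lv sum by linarith
      then show "v = 1" using b pos ln_eq_minus_one by simp
    next
      assume "v = 1"
      then show "ln u + b * ln v = 0" using sum by simp
    qed
    also have "v = 1 \<longleftrightarrow> z = b / (1 + b) * y"
      using b ypos by (auto simp: v_def field_simps)
    finally show ?thesis using le gap by linarith
  qed
  then show "ln c + b * ln z \<le> (1 + b) * ln y + (b * ln b - (1 + b) * ln (1 + b))"
    and "ln c + b * ln z = (1 + b) * ln y + (b * ln b - (1 + b) * ln (1 + b)) \<longleftrightarrow>
      z = b / (1 + b) * y"
    unfolding D_def by blast+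
qed

text \<open>Each summand is \<open>h t - h (Suc t)\<close> for
  \<open>h t = f (Suc T - t) * g t\<close>; exchanging \<open>Suc (T - t)\<close> for
  \<open>Suc T - t\<close> relies on \<open>t \<le> T\<close>, because subtraction
  truncates.\<close>

lemma sum_atMost_telescope_weighted:
  fixes f g :: "nat \<Rightarrow> real"
  shows "(\<Sum>t\<le>T. f (Suc (T - t)) * g t - f (T - t) * g (Suc t)) = f (Suc T) * g 0 - f 0 * g (Suc T)"
proof -
  have "(\<Sum>t\<le>T. f (Suc (T - t)) * g t - f (T - t) * g (Suc t)) =
    (\<Sum>t\<le>T. f (Suc T - t) * g t - f (Suc T - Suc t) * g (Suc t))"
    by (rule sum.cong) (auto simp: Suc_diff_le)
  also have "\<dots> = f (Suc T) * g 0 - f 0 * g (Suc T)"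
    using sum_telescope[of "\<lambda>t. f (Suc T - t) * g t" T] by simp
  finally show ?thesis .
qed

section \<open>Bounds and feasibility of the candidate\<close>

locale log_growth =
  fixes \<alpha> k0 :: real
  assumes \<alpha>: "0 < \<alpha>" "\<alpha> < 1" and k0: "0 < k0" "k0 < 1"
begin

lemma value_coeff_0 [simp]: "value_coeff \<alpha> 0 = 0"
  by (simp add: value_coeff_def)

text \<open>Bellman recursion: the optimal split of output \<open>y\<close> is worth
  \<open>(1 + value_coeff \<alpha> n) * ln y\<close> up to a constant, and
  \<open>y = k powr \<alpha>\<close> contributes the factor \<alpha>.\<close>

lemma value_coeff_Suc: "value_coeff \<alpha> (Suc n) = \<alpha> * (1 + value_coeff \<alpha> n)"
  using \<alpha> by (simp add: value_coeff_def field_simps)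

lemma value_coeff_nonneg: "0 \<le> value_coeff \<alpha> n"
  using \<alpha> by (simp add: value_coeff_def power_le_one)

lemma value_coeff_eq_0_iff: "value_coeff \<alpha> n = 0 \<longleftrightarrow> n = 0"
proof (cases n)
  case (Suc m)
  then show ?thesis using \<alpha> value_coeff_nonneg[of m] value_coeff_Suc[of m] by auto
qed simp

lemma saving_rate_bounds: "0 \<le> saving_rate \<alpha> n" "saving_rate \<alpha> n < 1"
  using value_coeff_nonneg[of n] by (auto simp: saving_rate_def)

lemma saving_rate_eq_0_iff: "saving_rate \<alpha> n = 0 \<longleftrightarrow> n = 0"
  using value_coeff_nonneg[of n] value_coeff_eq_0_iff[of n] by (auto simp: saving_rate_def)

lemma capital_path_bounds:
  "t \<le> T \<Longrightarrow> 0 < capital_path \<alpha> k0 T t \<and> capital_path \<alpha> k0 T t < 1"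
proof (induction t)
  case 0
  then show ?case using k0 by simp
next
  case (Suc t)
  define x where "x = capital_path \<alpha> k0 T t"
  have x: "0 < x" "x < 1" using Suc by (auto simp: x_def)
  have y: "0 < x powr \<alpha>" "x powr \<alpha> < 1"
    using x \<alpha> powr_less_mono2[of \<alpha> x 1] by auto
  \<comment> \<open>\<open>Suc t \<le> T\<close> gives \<open>T - t > 0\<close>, hence a strictly
    positive rate.\<close>
  have s: "0 < saving_rate \<alpha> (T - t)" "saving_rate \<alpha> (T - t) < 1"
    using Suc.prems saving_rate_bounds[of "T - t"] saving_rate_eq_0_iff[of "T - t"]
    by (auto simp: less_le)
  have "saving_rate \<alpha> (T - t) * x powr \<alpha> < 1 * 1"
    using s y by (intro mult_strict_mono) auto
  then show ?case using s y by (simp add: x_def)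
qed

lemma candidate_feasible: "feasible \<alpha> k0 T (candidate \<alpha> k0 T)"
proof -
  have "0 < consumption_path \<alpha> k0 T t" if "t \<le> T" for t
    using capital_path_bounds[OF that] saving_rate_bounds(2)[of "T - t"]
    by (simp add: consumption_path_def)
  moreover have "consumption_path \<alpha> k0 T t + capital_path \<alpha> k0 T (Suc t) =
      capital_path \<alpha> k0 T t powr \<alpha>" for t
    by (simp add: consumption_path_def algebra_simps)
  ultimately show ?thesis
    using capital_path_bounds[of _ T] saving_rate_eq_0_iff[of 0]
    by (auto simp: feasible_def candidate_def simp del: capital_path.simps(2))
      (simp add: capital_path.simps(2))
qed

section \<open>Optimality and uniqueness\<close>

text \<open>The value function at \<open>k0\<close>: what remains after telescoping, plus the
  constants of \<open>log_split_bound\<close>.\<close>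

definition max_utility :: "nat \<Rightarrow> real" where
  "max_utility T = value_coeff \<alpha> (Suc T) * ln k0 +
     (\<Sum>t\<le>T. let b = value_coeff \<alpha> (T - t) in b * ln b - (1 + b) * ln (1 + b))"

lemma feasible_utility:
  assumes feas: "feasible \<alpha> k0 T (k, c)"
  shows "total_utility T (k, c) \<le> max_utility T"
    and "total_utility T (k, c) = max_utility T \<longleftrightarrow>
      (\<forall>t\<le>T. k (Suc t) = saving_rate \<alpha> (T - t) * k t powr \<alpha>)"
proof -
  define b where "b t = value_coeff \<alpha> (T - t)" for t
  define D where "D t = b t * ln (b t) - (1 + b t) * ln (1 + b t)" for t
  \<comment> \<open>\<open>W t\<close> is the loss of continuation value from \<open>t\<close> to
    \<open>Suc t\<close>, the most that consumption at \<open>t\<close> can make up for.\<close>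
  define W where "W t = value_coeff \<alpha> (Suc (T - t)) * ln (k t) - b t * ln (k (Suc t)) + D t" for t
  have step: "ln (c t) \<le> W t \<and>
      (ln (c t) = W t \<longleftrightarrow> k (Suc t) = saving_rate \<alpha> (T - t) * k t powr \<alpha>)"
    if t: "t \<le> T" for t
  proof -
    have kt: "0 < k t" and ct: "0 < c t" and bud: "c t + k (Suc t) = k t powr \<alpha>"
      using feas t by (auto simp: feasible_def)
    \<comment> \<open>In the last period both quantities are 0; in all earlier ones both are
      positive.\<close>
    have nxt: "0 \<le> k (Suc t)" "b t = 0 \<longleftrightarrow> k (Suc t) = 0"
    proof (atomize (full), cases "t = T")
      case True
      then show "0 \<le> k (Suc t) \<and> (b t = 0 \<longleftrightarrow> k (Suc t) = 0)"
        using feas by (simp add: feasible_def b_def)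
    next
      case False
      then have "0 < k (Suc t)" using feas t by (auto simp: feasible_def)
      then show "0 \<le> k (Suc t) \<and> (b t = 0 \<longleftrightarrow> k (Suc t) = 0)"
        using False t value_coeff_eq_0_iff by (simp add: b_def)
    qed
    have "(1 + b t) * ln (k t powr \<alpha>) = value_coeff \<alpha> (Suc (T - t)) * ln (k t)"
      using kt by (simp add: value_coeff_Suc b_def ln_powr)
    then have W: "W t = (1 + b t) * ln (k t powr \<alpha>) + D t - b t * ln (k (Suc t))"
      unfolding W_def by linarith
    have s: "saving_rate \<alpha> (T - t) = b t / (1 + b t)"
      by (simp add: saving_rate_def b_def)
    note bound = log_split_bound[OF _ ct nxt(1) bud nxt(2), folded D_def]
    have "0 \<le> b t" by (simp add: b_def value_coeff_nonneg)
    then show ?thesis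
      unfolding W s bound(2)[OF \<open>0 \<le> b t\<close>, symmetric] using bound(1) by auto
  qed
  \<comment> \<open>The boundary term at \<open>Suc T\<close> carries the factor
    \<open>value_coeff \<alpha> 0 = 0\<close>, so the default value of \<open>ln 0\<close> is
    harmless.\<close>
  have "(\<Sum>t\<le>T. W t) = max_utility T"
    using sum_atMost_telescope_weighted
      [where T = T and f = "value_coeff \<alpha>" and g = "\<lambda>t. ln (k t)"] feas
    by (simp add: W_def sum.distrib max_utility_def feasible_def Let_def b_def D_def)
  then have max: "max_utility T = (\<Sum>t\<le>T. W t)" ..
  have u: "total_utility T (k, c) = (\<Sum>t\<le>T. ln (c t))"
    by (simp add: total_utility_def)
  show "total_utility T (k, c) \<le> max_utility T"
    unfolding u max using step by (intro sum_mono) auto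
  have "(\<Sum>t\<le>T. ln (c t)) = (\<Sum>t\<le>T. W t) \<longleftrightarrow> (\<forall>t\<le>T. ln (c t) = W t)"
  proof
    assume eq: "(\<Sum>t\<le>T. ln (c t)) = (\<Sum>t\<le>T. W t)"
    then have "(\<Sum>t\<le>T. W t - ln (c t)) = 0" by (simp add: sum_subtractf)
    then have "\<forall>t\<in>{..T}. W t - ln (c t) = 0"
      using step by (subst (asm) sum_nonneg_eq_0_iff) auto
    then show "\<forall>t\<le>T. ln (c t) = W t" by auto
  qed (auto intro: sum.cong)
  then show "total_utility T (k, c) = max_utility T \<longleftrightarrow>
      (\<forall>t\<le>T. k (Suc t) = saving_rate \<alpha> (T - t) * k t powr \<alpha>)"
    unfolding u max using step by auto
qed

lemma candidate_utility: "total_utility T (candidate \<alpha> k0 T) = max_utility T"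
  using feasible_utility(2)[of T "fst (candidate \<alpha> k0 T)" "snd (candidate \<alpha> k0 T)"]
    candidate_feasible[of T]
  by (simp add: candidate_def)

text \<open>Tightness in every period is a recursion that determines \<open>k\<close> from
  \<open>k0\<close>; the budget then determines \<open>c\<close>, and extensionality settles the
  values outside the planning period.\<close>

lemma feasible_max_utility_unique:
  assumes feas: "feasible \<alpha> k0 T p" and max: "total_utility T p = max_utility T"
  shows "p = candidate \<alpha> k0 T"
proof -
  obtain k c where p: "p = (k, c)" by (cases p)
  have rec: "k (Suc t) = saving_rate \<alpha> (T - t) * k t powr \<alpha>" if "t \<le> T" for t
    using feasible_utility(2)[of T k c] feas max that by (simp add: p)
  have k: "k t = capital_path \<alpha> k0 T t" if "t \<le> Suc T" for t
    using that
  proof (induction t)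
    case 0
    then show ?case using feas by (simp add: p feasible_def)
  next
    case (Suc t)
    then show ?case using rec by simp
  qed
  have c: "c t = consumption_path \<alpha> k0 T t" if "t \<le> T" for t
  proof -
    have "c t = k t powr \<alpha> - k (Suc t)"
      using feas that by (force simp: p feasible_def)
    then show ?thesis
      using rec[OF that] k[of t] that by (simp add: consumption_path_def algebra_simps)
  qed
  have ext: "k \<in> extensional {..Suc T}" "c \<in> extensional {..T}"
    using feas by (auto simp: p feasible_def)
  have "k = restrict (capital_path \<alpha> k0 T) {..Suc T}"
    using ext k by (intro extensionalityI[of _ "{..Suc T}"]) auto
  moreover have "c = restrict (consumption_path \<alpha> k0 T) {..T}"
    using ext c by (intro extensionalityI[of _ "{..T}"]) auto
  ultimately show ?thesis by (simp add: p candidate_def)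
qed

lemma feasible_utility_le:
  assumes "feasible \<alpha> k0 T p"
  shows "total_utility T p \<le> max_utility T"
  using assms feasible_utility(1) by (cases p) auto

text \<open>The candidate attains the upper bound, so any optimum must attain it as well and
  uniqueness applies. This also makes the \<open>THE\<close> in \<open>opt_plan\<close> well
  defined.\<close>

lemma optimal_iff: "optimal \<alpha> k0 T p \<longleftrightarrow> p = candidate \<alpha> k0 T"
proof
  assume "optimal \<alpha> k0 T p"
  then have feas: "feasible \<alpha> k0 T p" and "\<not> total_utility T p < max_utility T"
    using candidate_feasible[of T] candidate_utility[of T, symmetric]
    by (auto simp only: optimal_def is_arg_max_def)
  then show "p = candidate \<alpha> k0 T"
    using feasible_max_utility_unique[OF feas] feasible_utility_le[OF feas] by simp
next
  assume "p = candidate \<alpha> k0 T"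
  then show "optimal \<alpha> k0 T p"
    using candidate_feasible[of T] candidate_utility[of T] feasible_utility_le[of T]
    by (auto simp: optimal_def is_arg_max_def not_less)
qed

lemma opt_plan_eq: "opt_plan \<alpha> k0 T = candidate \<alpha> k0 T"
  by (simp add: opt_plan_def optimal_iff)

lemma opt_capital_eq: "t \<le> T \<Longrightarrow> opt_capital \<alpha> k0 T t = capital_path \<alpha> k0 T t"
  by (simp add: opt_capital_def opt_plan_eq candidate_def)

lemma opt_consumption_eq: "t \<le> T \<Longrightarrow> opt_consumption \<alpha> k0 T t = consumption_path \<alpha> k0 T t"
  by (simp add: opt_consumption_def opt_plan_eq candidate_def)

section \<open>Steady state and limiting dynamics\<close>

lemma steady_capital_pos: "0 < steady_capital \<alpha>"
  using \<alpha> by (simp add: steady_capital_def)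

lemma steady_capital_powr: "steady_capital \<alpha> powr \<alpha> = \<alpha> powr (\<alpha> / (1 - \<alpha>))"
  by (simp add: steady_capital_def powr_powr)

lemma steady_capital_fixed: "\<alpha> * steady_capital \<alpha> powr \<alpha> = steady_capital \<alpha>"
proof -
  have "1 + \<alpha> / (1 - \<alpha>) = 1 / (1 - \<alpha>)" using \<alpha> by (simp add: field_simps)
  moreover have "\<alpha> * steady_capital \<alpha> powr \<alpha> = \<alpha> powr (1 + \<alpha> / (1 - \<alpha>))"
    using \<alpha> by (simp add: steady_capital_powr powr_add)
  ultimately show ?thesis by (simp add: steady_capital_def)
qed

lemma limit_path_pos: "0 < limit_path \<alpha> k0 t"
  using steady_capital_pos k0 by (simp add: limit_path_def)

lemma limit_path_0: "limit_path \<alpha> k0 0 = k0"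
  using steady_capital_pos k0 by (simp add: limit_path_def)

text \<open>The power \<alpha> turns the exponent \<open>\<alpha> ^ t\<close> into
  \<open>\<alpha> ^ Suc t\<close>, and the fixed point equation absorbs the factor \<alpha>.\<close>

lemma limit_path_Suc: "\<alpha> * limit_path \<alpha> k0 t powr \<alpha> = limit_path \<alpha> k0 (Suc t)"
proof -
  have "limit_path \<alpha> k0 t powr \<alpha> =
      steady_capital \<alpha> powr \<alpha> * (k0 / steady_capital \<alpha>) powr (\<alpha> ^ Suc t)"
    using steady_capital_pos k0
    by (simp add: limit_path_def powr_mult powr_powr mult.commute)
  then show ?thesis
    using steady_capital_fixed by (simp add: limit_path_def)
qed

lemma limit_path_tendsto: "limit_path \<alpha> k0 \<longlonglongrightarrow> steady_capital \<alpha>"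
proof -
  have "(\<lambda>t. \<alpha> ^ t) \<longlonglongrightarrow> 0" using \<alpha> by (intro LIMSEQ_power_zero) auto
  then have "(\<lambda>t. steady_capital \<alpha> * (k0 / steady_capital \<alpha>) powr (\<alpha> ^ t)) \<longlonglongrightarrow>
      steady_capital \<alpha> * (k0 / steady_capital \<alpha>) powr 0"
    using steady_capital_pos k0 by (intro tendsto_mult tendsto_powr tendsto_const) auto
  then show ?thesis
    using steady_capital_pos k0 by (simp add: limit_path_def[abs_def])
qed

lemma limit_path_antimono:
  assumes "steady_capital \<alpha> < k0"
  shows "strict_antimono_on UNIV (limit_path \<alpha> k0)"
proof -
  \<comment> \<open>For a base above 1 the powers follow the decreasing exponents
    \<open>\<alpha> ^ t\<close>; for a base below 1 the order reverses.\<close>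
  have "1 < k0 / steady_capital \<alpha>" using assms steady_capital_pos by simp
  then show ?thesis
    using \<alpha> steady_capital_pos
    by (auto simp: monotone_on_def limit_path_def power_strict_decreasing)
qed

lemma limit_path_mono:
  assumes "k0 < steady_capital \<alpha>"
  shows "strict_mono (limit_path \<alpha> k0)"
proof -
  have "k0 / steady_capital \<alpha> < 1" "0 < k0 / steady_capital \<alpha>"
    using assms steady_capital_pos k0 by simp_all
  then show ?thesis
    using \<alpha> steady_capital_pos
    by (auto simp: strict_mono_def limit_path_def intro!: powr_less_mono' power_strict_decreasing)
qed

lemma limit_path_steady: "k0 = steady_capital \<alpha> \<Longrightarrow> limit_path \<alpha> k0 t = k0"
  using k0 by (simp add: limit_path_def)

section \<open>Passage to the infinite horizon\<close>

lemma saving_rate_tendsto: "(\<lambda>T. saving_rate \<alpha> (T - t)) \<longlonglongrightarrow> \<alpha>"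
proof -
  have "(\<lambda>n. \<alpha> ^ n) \<longlonglongrightarrow> 0" using \<alpha> by (intro LIMSEQ_power_zero) auto
  then have "value_coeff \<alpha> \<longlonglongrightarrow> \<alpha> * (1 - 0) / (1 - \<alpha>)"
    unfolding value_coeff_def[abs_def] using \<alpha> by (intro tendsto_intros) auto
  then have "saving_rate \<alpha> \<longlonglongrightarrow> (\<alpha> * (1 - 0) / (1 - \<alpha>)) / (1 + \<alpha> * (1 - 0) / (1 - \<alpha>))"
    unfolding saving_rate_def[abs_def] using \<alpha>
    by (intro tendsto_intros) (auto simp: field_simps)
  also have "(\<alpha> * (1 - 0) / (1 - \<alpha>)) / (1 + \<alpha> * (1 - 0) / (1 - \<alpha>)) = \<alpha>"
    using \<alpha> by (simp add: field_simps)
  finally have "saving_rate \<alpha> \<longlonglongrightarrow> \<alpha>" .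
  then show ?thesis
    by (rule filterlim_compose) (rule filterlim_minus_const_nat_at_top)
qed

lemma capital_path_tendsto: "(\<lambda>T. capital_path \<alpha> k0 T t) \<longlonglongrightarrow> limit_path \<alpha> k0 t"
proof (induction t)
  case 0
  then show ?case by (simp add: limit_path_0)
next
  case (Suc t)
  have "(\<lambda>T. saving_rate \<alpha> (T - t) * capital_path \<alpha> k0 T t powr \<alpha>) \<longlonglongrightarrow>
      \<alpha> * limit_path \<alpha> k0 t powr \<alpha>"
    using limit_path_pos[of t] by (intro tendsto_intros saving_rate_tendsto Suc.IH) auto
  then show ?case by (simp add: limit_path_Suc)
qed

lemma opt_capital_tendsto: "(\<lambda>T. opt_capital \<alpha> k0 T t) \<longlonglongrightarrow> limit_path \<alpha> k0 t"
  using capital_path_tendsto[of t]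
  by (rule Lim_transform_eventually)
    (auto simp: eventually_sequentially opt_capital_eq intro!: exI[of _ t])

text \<open>Consumption is the share \<open>1 - \<alpha>\<close> of limiting output and next capital
  the share \<alpha>. Written as a multiple of next capital, consumption inherits monotonicity and
  convergence from \<open>limit_path\<close>.\<close>

lemma opt_consumption_tendsto:
  "(\<lambda>T. opt_consumption \<alpha> k0 T t) \<longlonglongrightarrow> (1 - \<alpha>) / \<alpha> * limit_path \<alpha> k0 (Suc t)"
proof -
  have "(\<lambda>T. (1 - saving_rate \<alpha> (T - t)) * capital_path \<alpha> k0 T t powr \<alpha>) \<longlonglongrightarrow>
      (1 - \<alpha>) * limit_path \<alpha> k0 t powr \<alpha>"
    using limit_path_pos[of t]
    by (intro tendsto_intros saving_rate_tendsto capital_path_tendsto) auto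
  then have "(\<lambda>T. consumption_path \<alpha> k0 T t) \<longlonglongrightarrow> (1 - \<alpha>) / \<alpha> * limit_path \<alpha> k0 (Suc t)"
    using \<alpha> by (simp add: consumption_path_def limit_path_Suc[symmetric])
  then show ?thesis
    by (rule Lim_transform_eventually)
      (auto simp: eventually_sequentially opt_consumption_eq intro!: exI[of _ t])
qed

lemma capital_lim_eq: "capital_lim \<alpha> k0 = limit_path \<alpha> k0"
  using opt_capital_tendsto by (simp add: fun_eq_iff capital_lim_def limI)

lemma consumption_lim_eq: "consumption_lim \<alpha> k0 t = (1 - \<alpha>) / \<alpha> * limit_path \<alpha> k0 (Suc t)"
  using opt_consumption_tendsto by (simp add: consumption_lim_def limI)

lemma consumption_lim_pos: "0 < consumption_lim \<alpha> k0 t"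
  using \<alpha> limit_path_pos by (simp add: consumption_lim_eq)

lemma shadow_price_lim_eq: "shadow_price_lim \<alpha> k0 t = 1 / consumption_lim \<alpha> k0 t"
proof -
  have "(\<lambda>T. shadow_price \<alpha> k0 T t) \<longlonglongrightarrow> 1 / consumption_lim \<alpha> k0 t"
    unfolding shadow_price_def
    using opt_consumption_tendsto[of t] consumption_lim_pos[of t]
    by (intro tendsto_intros) (auto simp: consumption_lim_eq)
  then show ?thesis by (simp add: shadow_price_lim_def limI)
qed

section \<open>Monotonicity and limits in time\<close>

lemma consumption_lim_less_iff:
  "consumption_lim \<alpha> k0 s < consumption_lim \<alpha> k0 t \<longleftrightarrow>
    limit_path \<alpha> k0 (Suc s) < limit_path \<alpha> k0 (Suc t)"
  using \<alpha> by (simp add: consumption_lim_eq mult_less_cancel_left_pos del: times_divide_eq_left)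

lemma shadow_price_lim_less_iff:
  "shadow_price_lim \<alpha> k0 s < shadow_price_lim \<alpha> k0 t \<longleftrightarrow>
    consumption_lim \<alpha> k0 t < consumption_lim \<alpha> k0 s"
  using consumption_lim_pos[of s] consumption_lim_pos[of t]
  by (simp add: shadow_price_lim_eq field_simps)

lemma consumption_lim_tendsto:
  "consumption_lim \<alpha> k0 \<longlonglongrightarrow> (1 - \<alpha>) * \<alpha> powr (\<alpha> / (1 - \<alpha>))"
proof -
  have "(\<lambda>t. (1 - \<alpha>) / \<alpha> * limit_path \<alpha> k0 (Suc t)) \<longlonglongrightarrow> (1 - \<alpha>) / \<alpha> * steady_capital \<alpha>"
    by (intro tendsto_intros LIMSEQ_Suc limit_path_tendsto)
  \<comment> \<open>The fixed point equation trades the division by \<alpha> for the power \<alpha>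
    of steady capital.\<close>
  moreover have "(1 - \<alpha>) / \<alpha> * steady_capital \<alpha> = (1 - \<alpha>) * \<alpha> powr (\<alpha> / (1 - \<alpha>))"
    using \<alpha> by (subst steady_capital_fixed[symmetric]) (simp add: steady_capital_powr)
  ultimately show ?thesis by (simp add: consumption_lim_eq[abs_def] fun_eq_iff)
qed

lemma shadow_price_lim_tendsto:
  "shadow_price_lim \<alpha> k0 \<longlonglongrightarrow> inverse (1 - \<alpha>) * \<alpha> powr (- \<alpha> / (1 - \<alpha>))"
proof -
  have "(\<lambda>t. 1 / consumption_lim \<alpha> k0 t) \<longlonglongrightarrow> 1 / ((1 - \<alpha>) * \<alpha> powr (\<alpha> / (1 - \<alpha>)))"
    using \<alpha> by (intro tendsto_intros consumption_lim_tendsto) auto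
  moreover have "1 / ((1 - \<alpha>) * \<alpha> powr (\<alpha> / (1 - \<alpha>))) = inverse (1 - \<alpha>) * \<alpha> powr (- \<alpha> / (1 - \<alpha>))"
    by (simp add: powr_minus field_simps)
  ultimately show ?thesis by (simp add: shadow_price_lim_eq[abs_def])
qed

end

theorem proposition1:
  fixes \<alpha> k0 :: real
  assumes "0 < \<alpha>" and "\<alpha> < 1" and "0 < k0" and "k0 < 1"
  shows
    "(consumption_lim \<alpha> k0 \<longlonglongrightarrow> (1 - \<alpha>) * \<alpha> powr (\<alpha> / (1 - \<alpha>)) \<and>
        0 < (1 - \<alpha>) * \<alpha> powr (\<alpha> / (1 - \<alpha>)) \<and>
      capital_lim \<alpha> k0 \<longlonglongrightarrow> \<alpha> powr (1 / (1 - \<alpha>)) \<and>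
        0 < \<alpha> powr (1 / (1 - \<alpha>)) \<and>
      shadow_price_lim \<alpha> k0 \<longlonglongrightarrow> inverse (1 - \<alpha>) * \<alpha> powr (- \<alpha> / (1 - \<alpha>)) \<and>
        0 < inverse (1 - \<alpha>) * \<alpha> powr (- \<alpha> / (1 - \<alpha>))) \<and>
     (k0 > \<alpha> powr (1 / (1 - \<alpha>)) \<longrightarrow>
        strict_antimono_on UNIV (capital_lim \<alpha> k0) \<and>
        strict_antimono_on UNIV (consumption_lim \<alpha> k0) \<and>
        strict_mono (shadow_price_lim \<alpha> k0)) \<and>
     (k0 < \<alpha> powr (1 / (1 - \<alpha>)) \<longrightarrow>
        strict_mono (capital_lim \<alpha> k0) \<and>
        strict_mono (consumption_lim \<alpha> k0) \<and>
        strict_antimono_on UNIV (shadow_price_lim \<alpha> k0)) \<and>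
     (k0 = \<alpha> powr (1 / (1 - \<alpha>)) \<longrightarrow>
        (\<forall>t. capital_lim \<alpha> k0 t = capital_lim \<alpha> k0 0) \<and>
        (\<forall>t. consumption_lim \<alpha> k0 t = consumption_lim \<alpha> k0 0) \<and>
        (\<forall>t. shadow_price_lim \<alpha> k0 t = shadow_price_lim \<alpha> k0 0))"
proof -
  interpret log_growth \<alpha> k0
    using assms by unfold_locales
  note limits = consumption_lim_tendsto limit_path_tendsto[unfolded steady_capital_def]
    shadow_price_lim_tendsto
  \<comment> \<open>Consumption follows capital one period ahead, and taking reciprocals reverses
    the order for prices.\<close>
  have decreasing: "strict_antimono_on UNIV (capital_lim \<alpha> k0) \<and>
      strict_antimono_on UNIV (consumption_lim \<alpha> k0) \<and> strict_mono (shadow_price_lim \<alpha> k0)"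
    if "k0 > \<alpha> powr (1 / (1 - \<alpha>))"
    using limit_path_antimono that
    by (simp add: capital_lim_eq monotone_on_def steady_capital_def strict_mono_def
        consumption_lim_less_iff shadow_price_lim_less_iff)
  have increasing: "strict_mono (capital_lim \<alpha> k0) \<and> strict_mono (consumption_lim \<alpha> k0) \<and>
      strict_antimono_on UNIV (shadow_price_lim \<alpha> k0)"
    if "k0 < \<alpha> powr (1 / (1 - \<alpha>))"
    using limit_path_mono that
    by (simp add: capital_lim_eq monotone_on_def steady_capital_def strict_mono_def
        consumption_lim_less_iff shadow_price_lim_less_iff)
  have steady: "capital_lim \<alpha> k0 t = capital_lim \<alpha> k0 0 \<and>
      consumption_lim \<alpha> k0 t = consumption_lim \<alpha> k0 0 \<and>
      shadow_price_lim \<alpha> k0 t = shadow_price_lim \<alpha> k0 0"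
    if "k0 = \<alpha> powr (1 / (1 - \<alpha>))" for t
    unfolding capital_lim_eq consumption_lim_eq shadow_price_lim_eq
    using limit_path_steady[unfolded steady_capital_def, OF that] by simp
  have "0 < \<alpha> powr (1 / (1 - \<alpha>))" "0 < (1 - \<alpha>) * \<alpha> powr (\<alpha> / (1 - \<alpha>))"
    "0 < inverse (1 - \<alpha>) * \<alpha> powr (- \<alpha> / (1 - \<alpha>))"
    using assms by simp_all
  with limits decreasing increasing steady show ?thesis
    unfolding capital_lim_eq by blast
qed

end
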